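(* For every integer $r\ge 1$ we have $\gamma_r(1)=\beta_r(1)=2$. Hence, $\beta_r(r-1)=\gamma_r(r-1)=2^r-2$.
   Context: Let $\mathbb{F}_2^r$ be the $r$-dimensional vector space over the two-element field, and let $0\le d\le r$ be an integer. A subset $C\subseteq\mathbb{F}_2^r$ is called $d$-complete if for every $v\in\mathbb{F}_2^r$ there exists a linear subspace $L_v\le\mathbb{F}_2^r$ of dimension $d$ such that $v+(L_v\setminus\{0\})\subseteq C$. By $\gamma_r(d)$ we denote the smallest possible size of a $d$-complete subset of $\mathbb{F}_2^r$. A subset $B\subseteq\mathbb{F}_2^r$ is called $d$-non-blocking if for every $v\in\mathbb{F}_2^r$ there exists a linear subspace $L_v\le\mathbb{F}_2^r$ of codimension $d$ (that is, of dimension $r-d$) such that $(v+(L_v\setminus\{0\}))\cap B=\varnothing$. By $\beta_r(d)$ we denote the largest possible size of a $d$-non-blocking subset of $\mathbb{F}_2^r$. *)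

theory Defs
  imports "HOL-Analysis.Analysis" "HOL-Library.Z2"
begin

text \<open>
  The space $F_2^r$ is \<^typ>\<open>bit ^ 'n\<close> with $r$ the cardinality of the index type \<open>'n\<close>
  (types are nonempty, so $r \ge 1$); \<^const>\<open>vec.subspace\<close> and \<^const>\<open>vec.dim\<close> are taken over
  the scalar field \<^typ>\<open>bit\<close>.
\<close>

instance bit :: finite
proof
  have "(UNIV :: bit set) = {0, 1}"
    using bit_not_zero_iff by blast
  then show "finite (UNIV :: bit set)"
    by (metis finite.emptyI finite.insertI)
qed

definition d_complete :: "nat \<Rightarrow> (bit ^ 'n) set \<Rightarrow> bool" where
  "d_complete d C \<longleftrightarrow>
     (\<forall>v. \<exists>L. vec.subspace L \<and> vec.dim L = d \<and> (\<lambda>u. v + u) ` (L - {0}) \<subseteq> C)"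

text \<open>Codimension \<open>d\<close> is written additively to avoid truncated subtraction.\<close>

definition d_non_blocking :: "nat \<Rightarrow> (bit ^ 'n) set \<Rightarrow> bool" where
  "d_non_blocking d B \<longleftrightarrow>
     (\<forall>v. \<exists>L. vec.subspace L \<and> vec.dim L + d = CARD('n) \<and>
            (\<lambda>u. v + u) ` (L - {0}) \<inter> B = {})"

text \<open>
  The argument of type \<open>'n itself\<close> carries the dimension $r$. For $0 \le d \le r$ the sets below
  are finite and nonempty, so \<^const>\<open>Min\<close> and \<^const>\<open>Max\<close> are attained; other \<open>d\<close> are irrelevant.
\<close>

definition gamma :: "'n::finite itself \<Rightarrow> nat \<Rightarrow> nat" where
  "gamma _ d = Min {card C | C :: (bit ^ 'n) set. d_complete d C}"

definition beta :: "'n::finite itself \<Rightarrow> nat \<Rightarrow> nat" where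
  "beta _ d = Max {card B | B :: (bit ^ 'n) set. d_non_blocking d B}"

lemma ex_subspace_dim:
  assumes "d \<le> CARD('n::finite)"
  shows "\<exists>L :: (bit ^ 'n) set. vec.subspace L \<and> vec.dim L = d"
proof -
  have "d \<le> vec.dim (UNIV :: (bit ^ 'n) set)"
    using assms by (simp only: vec_dim_card)
  then obtain L :: "(bit ^ 'n) set" where "vec.subspace L" "vec.dim L = d"
    using vec.choose_subspace_of_subspace by blast
  then show ?thesis by blast
qed

lemma gamma_well_defined:
  fixes d :: nat
  assumes "d \<le> CARD('n::finite)"
  shows "finite {card C | C :: (bit ^ 'n) set. d_complete d C}"
    and "{card C | C :: (bit ^ 'n) set. d_complete d C} \<noteq> {}"
proof -
  show "finite {card C | C :: (bit ^ 'n) set. d_complete d C}" by simp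
  have "d_complete d (UNIV :: (bit ^ 'n) set)"
    using ex_subspace_dim[OF assms] by (simp add: d_complete_def)
  then show "{card C | C :: (bit ^ 'n) set. d_complete d C} \<noteq> {}" by blast
qed

lemma beta_well_defined:
  fixes d :: nat
  assumes "d \<le> CARD('n::finite)"
  shows "finite {card B | B :: (bit ^ 'n) set. d_non_blocking d B}"
    and "{card B | B :: (bit ^ 'n) set. d_non_blocking d B} \<noteq> {}"
proof -
  show "finite {card B | B :: (bit ^ 'n) set. d_non_blocking d B}" by simp
  obtain L :: "(bit ^ 'n) set" where "vec.subspace L" "vec.dim L = CARD('n) - d"
    using ex_subspace_dim[where ?'n = 'n and d = "CARD('n) - d"] by auto
  then have "d_non_blocking d ({} :: (bit ^ 'n) set)"
    using assms by (auto simp: d_non_blocking_def)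
  then show "{card B | B :: (bit ^ 'n) set. d_non_blocking d B} \<noteq> {}" by blast
qed

end

theory Submission
  imports Defs
begin

text \<open>
  A set is \<open>d\<close>-non-blocking iff its complement is \<open>(r - d)\<close>-complete, so it suffices to treat
  \<open>d = 1\<close>. A set is 1-complete iff it lies in no singleton \<open>{v}\<close>, that is, iff it has
  at least two elements. Two nonzero vectors of \<open>F\<^sub>2\<^sup>r\<close> always avoid a common hyperplane, so pairs
  are 1-non-blocking; but for distinct \<open>a, b, c \<in> B\<close> the translate to \<open>v = a + b + c\<close> fails,
  since \<open>a - v\<close>, \<open>b - v\<close>, \<open>c - v\<close> sum to zero while a sum of two vectors
  outside a hyperplane lies inside it.
\<close>

lemma bit_vec_add_self [simp]: "x + x = (0 :: bit ^ 'n)"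
  by (simp add: vec_eq_iff)

lemma bit_vec_add_self_left [simp]: "x + (x + y) = (y :: bit ^ 'n)"
  by (simp flip: add.assoc)

lemma bit_vec_diff_eq_add: "x - y = x + (y :: bit ^ 'n)"
  by (simp add: diff_eq_eq add.assoc)

lemma bit_vec_add_eq_0_iff: "x + y = 0 \<longleftrightarrow> x = (y :: bit ^ 'n)"
  by (simp flip: bit_vec_diff_eq_add)

lemma card_bit_vec: "CARD(bit ^ 'n::finite) = 2 ^ CARD('n)"
proof -
  have "(UNIV :: bit set) = {0, 1}"
    using bit_not_zero_iff by blast
  then have "CARD(bit) = card {0, 1 :: bit}" by (rule arg_cong)
  then have "CARD(bit) = 2" by (simp add: numeral_2_eq_2)
  then show ?thesis by (simp only: CARD_vec)
qed

text \<open>Extend \<open>x\<close> and \<open>x + y\<close> to a basis and drop \<open>x\<close>: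
  the rest spans a hyperplane that contains \<open>x + y\<close> but not \<open>x\<close>, hence not
  \<open>y\<close> either.\<close>

lemma hyperplane_avoiding_two:
  fixes x y :: "bit ^ 'n::finite"
  assumes "x \<noteq> 0" "y \<noteq> 0"
  obtains L where "vec.subspace L" "vec.dim L + 1 = CARD('n)" "x \<notin> L" "y \<notin> L"
proof -
  \<comment> \<open>Removing 0 covers the case \<open>x = y\<close>, where \<open>x + y\<close>
    vanishes and would destroy independence.\<close>
  define S where "S = insert x ({x + y} - {0})"
  have "x + y \<notin> vec.span {x}"
    if "x + y \<noteq> 0"
  proof
    assume "x + y \<in> vec.span {x}"
    then obtain k where "x + y = k *s x"
      by (auto simp: vec.span_singleton)
    then show False
      \<comment> \<open>Over two scalars, \<open>k = 0\<close> gives \<open>x + y = 0\<close> and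
        \<open>k = 1\<close> gives \<open>y = 0\<close>.\<close>
      using that assms by (cases k) auto
  qed
  then have S: "vec.independent S"
    using assms
    by (cases "x + y = 0") (auto simp: S_def insert_commute[of x] vec.independent_insert)
  define T where "T = vec.extend_basis S"
  have T: "S \<subseteq> T" "vec.independent T" "vec.span T = UNIV"
    using S by (simp_all add: T_def vec.extend_basis_superset vec.independent_extend_basis)
  have xT: "x \<in> T" using T by (auto simp: S_def)
  have indep: "vec.independent (T - {x})"
    using T(2) vec.independent_mono by blast
  have finT: "finite T"
    using T(2) vec.finiteI_independent by blast
  have "card T = CARD('n)"
    using T vec.dim_span_eq_card_independent[of T] by (metis vec_dim_card)
  then have "vec.dim (vec.span (T - {x})) + 1 = CARD('n)"
    using indep xT finT
    by (simp add: vec.dim_eq_card_independent card_Suc_Diff1 del: card_Diff_singleton)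
  moreover have x: "x \<notin> vec.span (T - {x})"
    using T(2) xT vec.dependent_def by blast
  moreover have "y \<notin> vec.span (T - {x})"
  proof
    assume y: "y \<in> vec.span (T - {x})"
    have "x + y \<in> vec.span (T - {x})"
    proof (cases "x + y = 0")
      case False
      then have "x + y \<in> T - {x}"
        using T(1) assms by (auto simp: S_def)
      then show ?thesis by (rule vec.span_base)
    qed (simp add: vec.span_zero)
    then have "x + y + y \<in> vec.span (T - {x})"
      using y by (rule vec.span_add)
    with x show False by (simp add: add.assoc)
  qed
  ultimately show thesis
    using that vec.subspace_span by blast
qed

text \<open>Adjoining \<open>x\<close> to the hyperplane gives the whole space, so \<open>y\<close>
  lies in \<open>L\<close> up to a scalar multiple of \<open>x\<close>. The scalar is not 0 because
  \<open>y \<notin> L\<close>, so it is 1.\<close>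

lemma hyperplane_add_mem:
  fixes x y :: "bit ^ 'n::finite"
  assumes L: "vec.subspace L" "vec.dim L + 1 = CARD('n)" and "x \<notin> L" "y \<notin> L"
  shows "x + y \<in> L"
proof -
  have span: "vec.span L = L" using L(1) by (simp add: vec.span_eq_iff)
  have "vec.dim (insert x L) = CARD('n)"
    using L assms(3) by (simp add: vec.dim_insert span del: vec.span_eq_iff)
  then have "vec.span (insert x L) = UNIV"
    by (metis vec.dim_eq_full vec.dim_UNIV vec.dimension_def vec_dim_card)
  then obtain k where "y - k *s x \<in> L"
    unfolding vec.span_insert span by blast
  with assms(4) show ?thesis
    by (cases k) (auto simp: bit_vec_diff_eq_add add.commute)
qed

text \<open>A one-dimensional subspace over the two-element field is \<open>{0, u}\<close>, so the
  condition at \<open>v\<close> only asks for one point \<open>v + u\<close> of \<open>C\<close>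
  other than \<open>v\<close>.\<close>

lemma d_complete_1_iff:
  "d_complete 1 (C :: (bit ^ 'n::finite) set) \<longleftrightarrow> 2 \<le> card C"
proof
  assume C: "d_complete 1 C"
  have *: "\<exists>c \<in> C. c \<noteq> v" for v
  proof -
    obtain L where L: "vec.dim L = 1" "(\<lambda>u. v + u) ` (L - {0}) \<subseteq> C"
      using spec[OF C[unfolded d_complete_def], of v] by blast
    have "\<not> L \<subseteq> {0}"
      using L(1) vec.dim_eq_0[of L] by auto
    then obtain u where "u \<in> L" "u \<noteq> 0" by blast
    then have "v + u \<in> C" "v + u \<noteq> v" using L(2) by auto
    then show ?thesis by blast
  qed
  obtain a b where "a \<in> C" "b \<in> C" "a \<noteq> b" using * by metis
  then have "card {a, b} \<le> card C" by (intro card_mono) auto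
  with \<open>a \<noteq> b\<close> show "2 \<le> card C" by simp
next
  assume "2 \<le> card C"
  then obtain a b where ab: "a \<in> C" "b \<in> C" "a \<noteq> b"
    by (metis card_2_iff' obtain_subset_with_card_n subset_iff)
  show "d_complete 1 C"
    unfolding d_complete_def
  proof
    fix v
    obtain c where c: "c \<in> C" "c \<noteq> v" using ab by metis
    define L where "L = vec.span {v + c}"
    have "v + c \<noteq> 0" using c by (simp add: bit_vec_add_eq_0_iff)
    then have "vec.dim L = 1"
      unfolding L_def by (subst vec.dim_span_eq_card_independent) auto
    moreover have "v + u \<in> C" if u: "u \<in> L" "u \<noteq> 0" for u
    proof -
      obtain k where k: "u = k *s (v + c)"
        using u(1) by (auto simp only: L_def vec.span_singleton)
      with u(2) have "u = v + c" by (cases k) auto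
      with c show ?thesis by simp
    qed
    moreover have "vec.subspace L" by (simp add: L_def)
    ultimately show "\<exists>L. vec.subspace L \<and> vec.dim L = 1 \<and> (\<lambda>u. v + u) ` (L - {0}) \<subseteq> C"
      by blast
  qed
qed

lemma d_non_blocking_1_pair:
  fixes a b :: "bit ^ 'n::finite"
  assumes "a \<noteq> b"
  shows "d_non_blocking 1 {a, b}"
  unfolding d_non_blocking_def
proof
  fix v
  \<comment> \<open>The hyperplane must miss those of \<open>v + a\<close> and \<open>v + b\<close>
    that are nonzero. If \<open>v\<close> is one of the two points, its zero translate is exempt and
    the other translate takes its place.\<close>
  define x where "x = (if v = a then v + b else v + a)"
  define y where "y = (if v = b then v + a else v + b)"
  have "x \<noteq> 0" "y \<noteq> 0"
    using assms by (auto simp: x_def y_def bit_vec_add_eq_0_iff)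
  then obtain L where L: "vec.subspace L" "vec.dim L + 1 = CARD('n)" "x \<notin> L" "y \<notin> L"
    by (rule hyperplane_avoiding_two)
  have "v + u \<notin> {a, b}" if u: "u \<in> L" "u \<noteq> 0" for u
  proof
    assume "v + u \<in> {a, b}"
    then have "u = v + a \<or> u = v + b" by auto
    with u L show False by (auto simp: x_def y_def split: if_splits)
  qed
  with L show "\<exists>L. vec.subspace L \<and> vec.dim L + 1 = CARD('n) \<and>
      (\<lambda>u. v + u) ` (L - {0}) \<inter> {a, b} = {}"
    by blast
qed

lemma d_non_blocking_1_card_le:
  fixes B :: "(bit ^ 'n::finite) set"
  assumes "d_non_blocking 1 B"
  shows "card B \<le> 2"
proof (rule ccontr)
  assume "\<not> card B \<le> 2"
  then have "3 \<le> card B" by simp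
  then obtain T where T: "T \<subseteq> B" "card T = 3"
    by (metis obtain_subset_with_card_n)
  then obtain a b c where abc: "T = {a, b, c}" "a \<noteq> b" "a \<noteq> c" "b \<noteq> c"
    by (auto simp: card_3_iff)
  define v where "v = a + b + c"
  obtain L where L: "vec.subspace L" "vec.dim L + 1 = CARD('n)"
      "(\<lambda>u. v + u) ` (L - {0}) \<inter> B = {}"
    using spec[OF assms[unfolded d_non_blocking_def], of v] by blast
  have avoid: "u \<notin> L" if "v + u \<in> B" "u \<noteq> 0" for u
    using L(3) that by blast
  have sums: "v + (b + c) = a" "v + (a + c) = b" "v + (a + b) = c"
    by (simp_all only: v_def ac_simps bit_vec_add_self_left bit_vec_add_self add_0_left add_0_right)
  have "a \<in> B" "b \<in> B" "c \<in> B" using abc(1) T(1) by blast+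
  \<comment> \<open>Distinctness keeps the translates of \<open>a\<close>, \<open>b\<close>,
    \<open>c\<close> away from 0, the one vector of \<open>L\<close> exempt from the
    condition.\<close>
  moreover have "b + c \<noteq> 0" "a + c \<noteq> 0" "a + b \<noteq> 0"
    using abc by (simp_all add: bit_vec_add_eq_0_iff)
  ultimately have "b + c \<notin> L" "a + c \<notin> L" "a + b \<notin> L"
    using avoid sums by metis+
  moreover have "(b + c) + (a + c) = a + b"
    by (simp only: ac_simps bit_vec_add_self add_0_left add_0_right)
  ultimately show False
    using hyperplane_add_mem[OF L(1,2), of "b + c" "a + c"] by metis
qed

lemma d_non_blocking_iff_d_complete_Compl:
  fixes B :: "(bit ^ 'n::finite) set"
  assumes "d \<le> CARD('n)"
  shows "d_non_blocking d B \<longleftrightarrow> d_complete (CARD('n) - d) (- B)"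
proof -
  have "k + d = CARD('n) \<longleftrightarrow> k = CARD('n) - d" for k
    using assms by auto
  then show ?thesis
    unfolding d_non_blocking_def d_complete_def by (simp add: disjoint_eq_subset_Compl)
qed

text \<open>Complementation matches the two families of sets and reverses their sizes, so a largest
  non-blocking set is the complement of a smallest complete one.\<close>

lemma beta_eq_gamma:
  assumes d: "d \<le> CARD('n::finite)"
  shows "beta TYPE('n) d = 2 ^ CARD('n) - gamma TYPE('n) (CARD('n) - d)"
proof -
  let ?G = "{card C | C :: (bit ^ 'n) set. d_complete (CARD('n) - d) C}"
  have G: "finite ?G" "?G \<noteq> {}"
    using gamma_well_defined[where ?'n = 'n and d = "CARD('n) - d"] by simp_all
  have compl: "card (- C) = 2 ^ CARD('n) - card C" for C :: "(bit ^ 'n) set"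
    by (simp add: Compl_eq_Diff_UNIV card_Diff_subset card_bit_vec del: CARD_vec)
  show ?thesis
    unfolding beta_def
  proof (rule Max_eqI)
    fix k assume "k \<in> {card B | B :: (bit ^ 'n) set. d_non_blocking d B}"
    then obtain B :: "(bit ^ 'n) set" where B: "k = card B" "d_complete (CARD('n) - d) (- B)"
      using d_non_blocking_iff_d_complete_Compl[OF d] by blast
    then have "gamma TYPE('n) (CARD('n) - d) \<le> card (- B)"
      unfolding gamma_def using G(1) by (intro Min_le) auto
    moreover have "k = 2 ^ CARD('n) - card (- B)"
      using B(1) compl[of "- B"] by simp
    ultimately show "k \<le> 2 ^ CARD('n) - gamma TYPE('n) (CARD('n) - d)" by simp
  next
    obtain C :: "(bit ^ 'n) set"
      where "gamma TYPE('n) (CARD('n) - d) = card C" "d_complete (CARD('n) - d) C"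
      using Min_in[OF G] unfolding gamma_def by blast
    then have "2 ^ CARD('n) - gamma TYPE('n) (CARD('n) - d) = card (- C)"
      "d_non_blocking d (- C)"
      by (simp_all add: compl d_non_blocking_iff_d_complete_Compl[OF d])
    then show "2 ^ CARD('n) - gamma TYPE('n) (CARD('n) - d)
        \<in> {card B | B :: (bit ^ 'n) set. d_non_blocking d B}"
      by blast
  qed (rule beta_well_defined[OF d])
qed

theorem theorem1:
  fixes r :: nat
  assumes "r = CARD('n::finite)"
  shows "gamma TYPE('n) 1 = 2 \<and> beta TYPE('n) 1 = 2 \<and>
         beta TYPE('n) (r - 1) = 2 ^ r - 2 \<and> gamma TYPE('n) (r - 1) = 2 ^ r - 2"
proof -
  have r: "1 \<le> CARD('n)" by (simp add: Suc_le_eq)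
  \<comment> \<open>The zero and all-ones vectors differ because the index type is nonempty.\<close>
  have "(0 :: bit ^ 'n) \<noteq> 1" by (simp add: vec_eq_iff)
  then obtain a b :: "bit ^ 'n" where ab: "a \<noteq> b" by blast
  have gamma1: "gamma TYPE('n) 1 = 2"
    unfolding gamma_def
  proof (rule Min_eqI)
    have "card {a, b} = 2" using ab by simp
    then show "2 \<in> {card C | C :: (bit ^ 'n) set. d_complete 1 C}"
      using d_complete_1_iff[of "{a, b}"] by (metis (mono_tags, lifting) mem_Collect_eq order_refl)
  qed (auto simp: d_complete_1_iff simp del: One_nat_def)
  have beta1: "beta TYPE('n) 1 = 2"
    unfolding beta_def
  proof (rule Max_eqI)
    have "card {a, b} = 2" using ab by simp
    then show "2 \<in> {card B | B :: (bit ^ 'n) set. d_non_blocking 1 B}"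
      using d_non_blocking_1_pair[OF ab] by (metis (mono_tags, lifting) mem_Collect_eq)
  qed (auto dest: d_non_blocking_1_card_le simp del: One_nat_def)
  have "beta TYPE('n) (CARD('n) - 1) = 2 ^ CARD('n) - 2"
    using beta_eq_gamma[where ?'n = 'n and d = "CARD('n) - 1"] gamma1 r by simp
  \<comment> \<open>Duality at \<open>d = 1\<close> reads
    \<open>2 = 2 ^ CARD('n) - gamma TYPE('n) (CARD('n) - 1)\<close>. The left side is positive, so
    the subtraction is not truncated and can be solved for \<open>gamma\<close>.\<close>
  moreover have "gamma TYPE('n) (CARD('n) - 1) = 2 ^ CARD('n) - 2"
    using beta_eq_gamma[where ?'n = 'n and d = 1] beta1 r by simp
  ultimately show ?thesis
    using assms gamma1 beta1 by simp
qed

end
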